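(* Let $X$ be a set of cardinality $|X|\ge 3$ and let $G$ be a subgroup of the symmetric group $S(X)$ with $S_\omega(X)\subset G$. Then $$\mathfrak Z_G''\subset\mathfrak Z_G'=\mathfrak Z_G=\mathcal T_p .$$ If the set $X$ is infinite, then moreover $\mathfrak Z_G''\ne\mathfrak Z_G'$.
   Context: $S(X)$ is the group of all bijections of $X$ under composition; $\mathrm{supt}(f)=\{x\in X: f(x)\ne x\}$; $S_\omega(X)\subset S(X)$ is the subgroup of permutations with finite support. $\mathcal T_p$ denotes the topology of pointwise convergence on $G$, i.e. the subspace topology inherited from the Tychonoff power $X^X$ where $X$ is discrete. For a group $G$ with identity $1_G$: - the Zariski topology $\mathfrak Z_G$ is generated by the sub-base consisting of the sets $\{x\in G: x^{\varepsilon_1}g_1x^{\varepsilon_2}g_2\cdots x^{\varepsilon_n}g_n\ne 1_G\}$, where $n\in\mathbb N$, $g_1,\dots,g_n\in G$, $\varepsilon_1,\dots,\varepsilon_n\in\{-1,1\}$; - $\mathfrak Z_G''$ is the topology generated by the sub-base consisting of the sets $\{x\in G: xbx^{-1}\ne aba^{-1}\}$, where $a,b\in G$ and $b^2=1_G$; - $\mathfrak Z_G'$ is the topology generated by the sub-base consisting of the sets $\{x\in G: xbx^{-1}\ne aba^{-1}\}$ and $\{x\in G:(xcx^{-1})b(xcx^{-1})^{-1}\ne b\}$, where $a,b,c\in G$ and $b^2=c^2=1_G$. Inclusion of topologies is inclusion of families of open sets. *)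

theory Defs
  imports "HOL-Analysis.Function_Topology" "HOL-Algebra.Bij"
begin

definition supt :: "'a set \<Rightarrow> ('a \<Rightarrow> 'a) \<Rightarrow> 'a set" where
  "supt X f = {x \<in> X. f x \<noteq> x}"

definition finitary_perms :: "'a set \<Rightarrow> ('a \<Rightarrow> 'a) set" where
  "finitary_perms X = {f \<in> Bij X. finite (supt X f)}"

(* The value at x of the word x^e1 g1 x^e2 g2 ... x^en gn encoded by the list
   [(e1, g1), ..., (en, gn)]. *)
definition word_value ::
    "('g, 'm) monoid_scheme \<Rightarrow> (int \<times> 'g) list \<Rightarrow> 'g \<Rightarrow> 'g" where
  "word_value G ws x =
     foldr (\<lambda>(e, g) r. (x [^]\<^bsub>G\<^esub> e) \<otimes>\<^bsub>G\<^esub> g \<otimes>\<^bsub>G\<^esub> r) ws \<one>\<^bsub>G\<^esub>"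

(* topology_generated_by S lives on the union of S.  Inserting the carrier (the empty
   intersection of sub-basic sets) makes each of the following a topology on all of G,
   whether or not the sub-basic sets cover G. *)

definition zariski_topology :: "('g, 'm) monoid_scheme \<Rightarrow> 'g topology" where
  "zariski_topology G = topology_generated_by (insert (carrier G)
     {{x \<in> carrier G. word_value G ws x \<noteq> \<one>\<^bsub>G\<^esub>} | ws.
        ws \<noteq> [] \<and> set ws \<subseteq> {-1, 1} \<times> carrier G})"

definition conj_subbase :: "('g, 'm) monoid_scheme \<Rightarrow> 'g set set" where
  "conj_subbase G =
     {{x \<in> carrier G.
         x \<otimes>\<^bsub>G\<^esub> b \<otimes>\<^bsub>G\<^esub> inv\<^bsub>G\<^esub> x \<noteq> a \<otimes>\<^bsub>G\<^esub> b \<otimes>\<^bsub>G\<^esub> inv\<^bsub>G\<^esub> a} | a b.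
        a \<in> carrier G \<and> b \<in> carrier G \<and> b [^]\<^bsub>G\<^esub> (2::nat) = \<one>\<^bsub>G\<^esub>}"

definition comm_subbase :: "('g, 'm) monoid_scheme \<Rightarrow> 'g set set" where
  "comm_subbase G =
     {{x \<in> carrier G.
         (x \<otimes>\<^bsub>G\<^esub> c \<otimes>\<^bsub>G\<^esub> inv\<^bsub>G\<^esub> x) \<otimes>\<^bsub>G\<^esub> b
           \<otimes>\<^bsub>G\<^esub> inv\<^bsub>G\<^esub> (x \<otimes>\<^bsub>G\<^esub> c \<otimes>\<^bsub>G\<^esub> inv\<^bsub>G\<^esub> x) \<noteq> b} | b c.
        b \<in> carrier G \<and> c \<in> carrier G \<and>
        b [^]\<^bsub>G\<^esub> (2::nat) = \<one>\<^bsub>G\<^esub> \<and> c [^]\<^bsub>G\<^esub> (2::nat) = \<one>\<^bsub>G\<^esub>}"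

definition zariski_topology'' :: "('g, 'm) monoid_scheme \<Rightarrow> 'g topology" where
  "zariski_topology'' G = topology_generated_by (insert (carrier G) (conj_subbase G))"

definition zariski_topology' :: "('g, 'm) monoid_scheme \<Rightarrow> 'g topology" where
  "zariski_topology' G =
     topology_generated_by (insert (carrier G) (conj_subbase G \<union> comm_subbase G))"

(* Elements of Bij X are extensional, so G \<subseteq> Bij X is a subset of the underlying set
   PiE X (\<lambda>_. X) of the Tychonoff power. *)
definition pointwise_topology ::
    "'a set \<Rightarrow> ('a \<Rightarrow> 'a) set \<Rightarrow> ('a \<Rightarrow> 'a) topology" where
  "pointwise_topology X G =
     subtopology (product_topology (\<lambda>_. discrete_topology X) X) G"

end

theory Submission
  imports Defs "HOL-Combinatorics.Transposition"
begin

text \<open>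
  That \<open>\<Z>\<close> is coarser than \<open>\<T>\<^sub>p\<close> holds because the image of a point under a word in \<open>x\<close>
  depends on finitely many values of \<open>x\<close>.  Conversely, for transpositions \<open>c = (u v)\<close> and
  \<open>b = (r s)\<close>, the conjugate \<open>x c x\<^sup>-\<^sup>1 = (x u  x v)\<close> fails to commute with \<open>b\<close> iff exactly one of
  \<open>x u\<close>, \<open>x v\<close> lies in \<open>{r, s}\<close>.  For infinite \<open>X\<close>, a few such conditions force \<open>x p = q\<close>; for finite
  \<open>X\<close>, already \<open>\<Z>''\<close> is \<open>T\<^sub>1\<close> on a finite set, hence discrete.  Finally, if \<open>X\<close> is
  infinite, finitely many conditions \<open>x b x\<^sup>-\<^sup>1 \<noteq> a b a\<^sup>-\<^sup>1\<close> that hold at \<open>x = 1\<close> are also satisfied by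
  a permutation moving \<open>p\<close>, namely one that swaps a finite set with a disjoint set in general
  position.  So the stabilizer of \<open>p\<close> is not \<open>\<Z>''\<close>-open.
\<close>

section \<open>Topologies generated by a sub-base\<close>

lemma openin_topology_generated_by_le:
  assumes "\<And>S. S \<in> \<S> \<Longrightarrow> openin T S" "openin (topology_generated_by \<S>) U"
  shows "openin T U"
proof -
  have "generate_topology_on \<S> U"
    using assms(2) by (rule openin_topology_generated_by)
  then show ?thesis
    by (induction) (auto intro: assms(1))
qed

text \<open>Finite intersections of sub-basic sets form a base. Requiring
  \<open>\<F> \<noteq> {}\<close> matters because \<open>\<Inter>{}\<close> is the whole type, which
  need not be generated by \<open>\<S>\<close>.\<close>

lemma openin_topology_generated_by_finite_Inter:
  assumes "openin (topology_generated_by \<S>) U" "x \<in> U"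
  obtains \<F> where "finite \<F>" "\<F> \<subseteq> \<S>" "\<F> \<noteq> {}" "x \<in> \<Inter>\<F>" "\<Inter>\<F> \<subseteq> U"
proof -
  have "generate_topology_on \<S> U"
    using assms(1) by (rule openin_topology_generated_by)
  then have "\<exists>\<F>. finite \<F> \<and> \<F> \<subseteq> \<S> \<and> \<F> \<noteq> {} \<and> x \<in> \<Inter>\<F> \<and> \<Inter>\<F> \<subseteq> U"
    using \<open>x \<in> U\<close>
  proof (induction)
    case (Int A B)
    then obtain \<F> \<G> where
      "finite \<F>" "\<F> \<subseteq> \<S>" "\<F> \<noteq> {}" "x \<in> \<Inter>\<F>" "\<Inter>\<F> \<subseteq> A"
      "finite \<G>" "\<G> \<subseteq> \<S>" "\<G> \<noteq> {}" "x \<in> \<Inter>\<G>" "\<Inter>\<G> \<subseteq> B"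
      by auto
    then show ?case
      by (intro exI[of _ "\<F> \<union> \<G>"]) blast
  next
    case (UN K)
    then obtain k where "k \<in> K" "x \<in> k" by blast
    from UN.IH[OF this] obtain \<F> where
      "finite \<F>" "\<F> \<subseteq> \<S>" "\<F> \<noteq> {}" "x \<in> \<Inter>\<F>" "\<Inter>\<F> \<subseteq> k" by (elim exE conjE)
    moreover from \<open>\<Inter>\<F> \<subseteq> k\<close> \<open>k \<in> K\<close> have "\<Inter>\<F> \<subseteq> \<Union>K" by (meson Sup_upper order_trans)
    ultimately show ?case by (intro exI[of _ \<F>] conjI)
  next
    case (Basis s)
    then show ?case by (intro exI[of _ "{s}"]) auto
  qed simp
  then show thesis by (elim exE conjE) (rule that)
qed

section \<open>Inclusions valid in every group\<close>

lemma zariski_topology''_le_zariski_topology':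
  assumes "openin (zariski_topology'' G) U"
  shows "openin (zariski_topology' G) U"
proof (rule openin_topology_generated_by_le[OF _ assms[unfolded zariski_topology''_def]])
  fix S assume "S \<in> insert (carrier G) (conj_subbase G)"
  then show "openin (zariski_topology' G) S"
    unfolding zariski_topology'_def by (intro topology_generated_by_Basis) auto
qed

lemma (in group) mult_inv_eq_one_iff:
  assumes "x \<in> carrier G" "y \<in> carrier G"
  shows "x \<otimes> inv y = \<one> \<longleftrightarrow> x = y"
proof
  assume "x \<otimes> inv y = \<one>"
  then have "inv (inv y) = x" using assms by (intro inv_equality) auto
  then show "x = y" using assms by simp
qed (use assms in simp)

text \<open>Multiplying a defining inequation by the inverse of its right-hand side turns it into a
  word in \<open>x\<close> that differs from \<open>\<one>\<close>.\<close>

lemma (in group) zariski_topology'_le_zariski_topology: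
  assumes "openin (zariski_topology' G) U"
  shows "openin (zariski_topology G) U"
proof (rule openin_topology_generated_by_le[OF _ assms[unfolded zariski_topology'_def]])
  fix S assume S: "S \<in> insert (carrier G) (conj_subbase G \<union> comm_subbase G)"
  have *: "openin (zariski_topology G) {x \<in> carrier G. word_value G ws x \<noteq> \<one>}"
    if "ws \<noteq> []" "set ws \<subseteq> {-1, 1} \<times> carrier G" for ws
    unfolding zariski_topology_def using that by (intro topology_generated_by_Basis) auto
  from S consider "S = carrier G" | "S \<in> conj_subbase G" | "S \<in> comm_subbase G" by blast
  then show "openin (zariski_topology G) S"
  proof cases
    case 1
    then show ?thesis
      unfolding zariski_topology_def by (intro topology_generated_by_Basis) auto
  next
    case 2
    then obtain a b where ab: "a \<in> carrier G" "b \<in> carrier G"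
      and S: "S = {x \<in> carrier G. x \<otimes> b \<otimes> inv x \<noteq> a \<otimes> b \<otimes> inv a}"
      unfolding conj_subbase_def by blast
    let ?ws = "[(1, b), (-1, inv (a \<otimes> b \<otimes> inv a))]"
    have "word_value G ?ws x = (x \<otimes> b \<otimes> inv x) \<otimes> inv (a \<otimes> b \<otimes> inv a)"
      if "x \<in> carrier G" for x
      using that ab by (simp add: word_value_def int_pow_neg m_assoc)
    then have "S = {x \<in> carrier G. word_value G ?ws x \<noteq> \<one>}"
      unfolding S using ab by (auto simp: mult_inv_eq_one_iff)
    then show ?thesis using *[of ?ws] ab by simp
  next
    case 3
    then obtain b c where bc: "b \<in> carrier G" "c \<in> carrier G"
      and S: "S = {x \<in> carrier G.
        (x \<otimes> c \<otimes> inv x) \<otimes> b \<otimes> inv (x \<otimes> c \<otimes> inv x) \<noteq> b}"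
      unfolding comm_subbase_def by blast
    \<comment> \<open>This is the commutator of \<open>x c inv x\<close> and \<open>b\<close>, with
      the inverse of the conjugate expanded to \<open>x (inv c) (inv x)\<close>.\<close>
    let ?ws = "[(1, c), (-1, b), (1, inv c), (-1, inv b)]"
    have "word_value G ?ws x = ((x \<otimes> c \<otimes> inv x) \<otimes> b \<otimes> inv (x \<otimes> c \<otimes> inv x)) \<otimes> inv b"
      if "x \<in> carrier G" for x
      using that bc by (simp add: word_value_def int_pow_neg m_assoc inv_mult_group)
    then have "S = {x \<in> carrier G. word_value G ?ws x \<noteq> \<one>}"
      unfolding S using bc by (auto simp: mult_inv_eq_one_iff)
    then show ?thesis using *[of ?ws] bc by simp
  qed
qed

section \<open>Cylinder neighbourhoods in the topology of pointwise convergence\<close>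

lemma openin_pointwise_topology_iff:
  assumes "H \<subseteq> X \<rightarrow>\<^sub>E X"
  shows "openin (pointwise_topology X H) U \<longleftrightarrow> U \<subseteq> H \<and>
    (\<forall>x\<in>U. \<exists>F. finite F \<and> F \<subseteq> X \<and> {y \<in> H. \<forall>p\<in>F. y p = x p} \<subseteq> U)"
    (is "?lhs \<longleftrightarrow> ?rhs")
proof
  assume ?lhs
  then obtain V where V: "openin (product_topology (\<lambda>_. discrete_topology X) X) V"
    and U: "U = V \<inter> H"
    unfolding pointwise_topology_def openin_subtopology by blast
  have "\<exists>F. finite F \<and> F \<subseteq> X \<and> {y \<in> H. \<forall>p\<in>F. y p = x p} \<subseteq> U" if "x \<in> U" for x
  proof -
    from that U V obtain W where W: "finite {i \<in> X. W i \<noteq> X}" "x \<in> Pi\<^sub>E X W" "Pi\<^sub>E X W \<subseteq> V"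
      unfolding openin_product_topology_alt by fastforce
    \<comment> \<open>Only the finitely many coordinates with \<open>W i \<noteq> X\<close>
      constrain \<open>y\<close>; outside \<open>X\<close> extensionality fixes its value.\<close>
    have "y \<in> Pi\<^sub>E X W" if "y \<in> H" "\<forall>p\<in>{i \<in> X. W i \<noteq> X}. y p = x p" for y
    proof (rule PiE_I)
      fix p assume "p \<in> X"
      with that W(2) assms show "y p \<in> W p" by (cases "W p = X") auto
    next
      fix p assume "p \<notin> X"
      with that assms show "y p = undefined" by auto
    qed
    with W show ?thesis
      unfolding U by (intro exI[of _ "{i \<in> X. W i \<noteq> X}"]) auto
  qed
  with U show ?rhs by blast
next
  assume R: ?rhs
  have "openin (pointwise_topology X H) U" if "\<forall>x\<in>U. \<exists>V. openin (pointwise_topology X H) V \<and> x \<in> V \<and> V \<subseteq> U"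
    using that by (subst openin_subopen) blast
  moreover have "\<exists>V. openin (pointwise_topology X H) V \<and> x \<in> V \<and> V \<subseteq> U" if x: "x \<in> U" for x
  proof -
    from R x obtain F where F: "finite F" "F \<subseteq> X" "{y \<in> H. \<forall>p\<in>F. y p = x p} \<subseteq> U" by blast
    from R x have xH: "x \<in> H" by blast
    define W where "W i = (if i \<in> F then {x i} else X)" for i
    have "openin (product_topology (\<lambda>_. discrete_topology X) X) (Pi\<^sub>E X W)"
      unfolding openin_PiE_gen using F xH assms
      by (auto simp: W_def intro: finite_subset[OF _ F(1)])
    then have "openin (pointwise_topology X H) (Pi\<^sub>E X W \<inter> H)"
      unfolding pointwise_topology_def openin_subtopology by blast
    moreover have "x \<in> Pi\<^sub>E X W \<inter> H" using xH assms by (auto simp: W_def PiE_iff)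
    moreover have "Pi\<^sub>E X W \<inter> H \<subseteq> {y \<in> H. \<forall>p\<in>F. y p = x p}"
      using F(2) by (force simp: W_def PiE_iff split: if_splits)
    ultimately show ?thesis using F(3) by (meson subset_trans)
  qed
  ultimately show ?lhs by simp
qed

text \<open>If exactly one of \<open>u\<close>, \<open>v\<close> lies in \<open>{r, s}\<close>, the
  transposition carries it out of the pair; otherwise the pair is permuted or fixed. This decides
  whether two transpositions commute.\<close>

lemma transpose_image_doubleton_eq_iff:
  assumes "u \<noteq> v" "r \<noteq> s"
  shows "{transpose u v r, transpose u v s} = {r, s} \<longleftrightarrow> (u \<in> {r, s} \<longleftrightarrow> v \<in> {r, s})"
  using assms by (auto simp: transpose_def doubleton_eq_iff split: if_splits)

section \<open>Permutation groups containing all finitary permutations, and their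
  transpositions\<close>

locale finitary_perm_group =
  fixes X :: "'a set" and H :: "('a \<Rightarrow> 'a) set" and G :: "('a \<Rightarrow> 'a) monoid" (structure)
  assumes subgroup_H: "subgroup H (BijGroup X)"
    and finitary: "finitary_perms X \<subseteq> H"
    and G_eq: "G = (BijGroup X)\<lparr>carrier := H\<rparr>"
begin

sublocale group G
  unfolding G_eq by (rule subgroup.subgroup_is_group[OF subgroup_H group_BijGroup])

lemma carrier_eq [simp]: "carrier G = H"
  by (simp add: G_eq)

lemma H_Bij: "x \<in> H \<Longrightarrow> x \<in> Bij X"
  using subgroup.subset[OF subgroup_H] by (auto simp: BijGroup_def)

lemma H_bij_betw: "x \<in> H \<Longrightarrow> bij_betw x X X"
  using H_Bij by (auto simp: Bij_def)

lemma H_apply_closed [simp]: "x \<in> H \<Longrightarrow> p \<in> X \<Longrightarrow> x p \<in> X"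
  using H_bij_betw by (auto dest: bij_betwE)

lemma H_subset_PiE: "H \<subseteq> X \<rightarrow>\<^sub>E X"
  using H_Bij by (fastforce simp: Bij_def extensional_def)

lemma H_apply_eq_iff: "x \<in> H \<Longrightarrow> p \<in> X \<Longrightarrow> q \<in> X \<Longrightarrow> x p = x q \<longleftrightarrow> p = q"
  using H_bij_betw by (metis bij_betw_def inj_on_eq_iff)

lemma H_ext: "x \<in> H \<Longrightarrow> y \<in> H \<Longrightarrow> (\<And>p. p \<in> X \<Longrightarrow> x p = y p) \<Longrightarrow> x = y"
  using H_subset_PiE by (meson PiE_ext subsetD)

lemma mult_apply [simp]: "x \<in> H \<Longrightarrow> y \<in> H \<Longrightarrow> p \<in> X \<Longrightarrow> (x \<otimes> y) p = x (y p)"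
  using H_Bij by (simp add: G_eq BijGroup_def compose_def)

lemma one_apply [simp]: "p \<in> X \<Longrightarrow> \<one> p = p"
  by (simp add: G_eq BijGroup_def)

lemma mult_in_H [simp]: "x \<in> H \<Longrightarrow> y \<in> H \<Longrightarrow> x \<otimes> y \<in> H"
  using m_closed by simp

lemma inv_in_H [simp]: "x \<in> H \<Longrightarrow> inv x \<in> H"
  using inv_closed by simp

lemma one_in_H [simp]: "\<one> \<in> H"
  using one_closed by simp

lemma inv_apply_left [simp]: "x \<in> H \<Longrightarrow> p \<in> X \<Longrightarrow> (inv x) (x p) = p"
  using mult_apply[of "inv x" x p] l_inv[of x] by simp

lemma inv_apply_right [simp]: "x \<in> H \<Longrightarrow> p \<in> X \<Longrightarrow> x ((inv x) p) = p"
  using mult_apply[of x "inv x" p] r_inv[of x] by simp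

definition swap :: "'a \<Rightarrow> 'a \<Rightarrow> 'a \<Rightarrow> 'a" where
  "swap r s = restrict (transpose r s) X"

lemma swap_apply [simp]: "p \<in> X \<Longrightarrow> swap r s p = transpose r s p"
  by (simp add: swap_def)

lemma transpose_in_X: "r \<in> X \<Longrightarrow> s \<in> X \<Longrightarrow> p \<in> X \<Longrightarrow> transpose r s p \<in> X"
  by (simp add: transpose_def)

text \<open>An involution is its own inverse, so bijectivity comes for free. All explicit elements
  of \<open>H\<close>, the transpositions and the generic permutation, are built this way.\<close>

lemma involution_in_H:
  assumes "\<And>p. p \<in> X \<Longrightarrow> f p \<in> X" "\<And>p. p \<in> X \<Longrightarrow> f (f p) = p" "finite {p \<in> X. f p \<noteq> p}"
  shows "restrict f X \<in> H"
proof -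
  have "bij_betw f X X"
    using assms(1,2) by (intro bij_betw_byWitness[of X f f]) auto
  moreover have "supt X (restrict f X) = {p \<in> X. f p \<noteq> p}"
    by (auto simp: supt_def)
  ultimately have "restrict f X \<in> finitary_perms X"
    using assms(3) by (simp add: finitary_perms_def Bij_def cong: bij_betw_cong)
  then show ?thesis using finitary by blast
qed

lemma swap_in_H [simp]:
  assumes "r \<in> X" "s \<in> X"
  shows "swap r s \<in> H"
  unfolding swap_def using assms
  by (intro involution_in_H)
    (auto simp: transpose_in_X transpose_def intro: finite_subset[of _ "{r, s}"])

lemma pow2_eq_oneI:
  assumes "x \<in> H" "\<And>p. p \<in> X \<Longrightarrow> x (x p) = p"
  shows "x [^] (2::nat) = \<one>"
proof -
  have "x \<otimes> x = \<one>" by (rule H_ext) (use assms in auto)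
  then show ?thesis using assms(1) by (simp add: numeral_2_eq_2)
qed

lemma swap_pow2 [simp]: "r \<in> X \<Longrightarrow> s \<in> X \<Longrightarrow> swap r s [^] (2::nat) = \<one>"
  by (intro pow2_eq_oneI) (simp_all add: transpose_in_X)

text \<open>This translates conditions on conjugates by \<open>x\<close> into conditions on two
  values of \<open>x\<close>.\<close>

lemma conj_swap:
  assumes "x \<in> H" "r \<in> X" "s \<in> X"
  shows "x \<otimes> swap r s \<otimes> inv x = swap (x r) (x s)"
proof (rule H_ext)
  fix p assume p: "p \<in> X"
  define q where "q = (inv x) p"
  have q: "q \<in> X" "p = x q" using p assms by (auto simp: q_def)
  then show "(x \<otimes> swap r s \<otimes> inv x) p = swap (x r) (x s) p"
    using assms by (simp add: transpose_def H_apply_eq_iff)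
qed (use assms in auto)

text \<open>The hypothesis \<open>r' \<noteq> s'\<close> excludes the identity, which equals
  \<open>swap r' r'\<close> for every \<open>r'\<close>.\<close>

lemma swap_eq_iff:
  assumes "r \<in> X" "s \<in> X" "r' \<in> X" "s' \<in> X" "r' \<noteq> s'"
  shows "swap r s = swap r' s' \<longleftrightarrow> {r, s} = {r', s'}"
proof
  assume "swap r s = swap r' s'"
  then have "transpose r s p = transpose r' s' p" if "p \<in> X" for p
    using that by (metis swap_apply)
  from this[of r'] this[of s'] show "{r, s} = {r', s'}"
    using assms by (auto simp: transpose_def split: if_splits)
next
  assume "{r, s} = {r', s'}"
  then show "swap r s = swap r' s'"
    by (auto simp: doubleton_eq_iff swap_def transpose_commute)
qed

section \<open>Pointwise open sets are open in \<open>zariski_topology' G\<close>\<close>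

text \<open>The sub-basic set for \<open>c = swap u v\<close> and \<open>b = swap r s\<close>:
  conjugating \<open>b\<close> by the transposition of \<open>x u\<close> and \<open>x v\<close>
  changes it iff the pair \<open>{r, s}\<close> is not preserved.\<close>

lemma openin_zariski'_swap:
  assumes "u \<in> X" "v \<in> X" "u \<noteq> v" "r \<in> X" "s \<in> X" "r \<noteq> s"
  shows "openin (zariski_topology' G) {x \<in> H. (x u \<in> {r, s}) \<noteq> (x v \<in> {r, s})}"
proof -
  let ?w = "\<lambda>x. x \<otimes> swap u v \<otimes> inv x"
  have "?w x \<otimes> swap r s \<otimes> inv (?w x) \<noteq> swap r s \<longleftrightarrow> (x u \<in> {r, s}) \<noteq> (x v \<in> {r, s})"
    if x: "x \<in> H" for x
  proof -
    have "?w x \<otimes> swap r s \<otimes> inv (?w x)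
        = swap (transpose (x u) (x v) r) (transpose (x u) (x v) s)"
      using x assms by (simp add: conj_swap)
    moreover have "x u \<noteq> x v" using x assms by (simp add: H_apply_eq_iff)
    ultimately show ?thesis
      using x assms by (simp add: swap_eq_iff transpose_in_X transpose_image_doubleton_eq_iff)
  qed
  then have "{x \<in> H. (x u \<in> {r, s}) \<noteq> (x v \<in> {r, s})}
      = {x \<in> carrier G. ?w x \<otimes> swap r s \<otimes> inv (?w x) \<noteq> swap r s}"
    by auto
  also have "\<dots> \<in> comm_subbase G"
    unfolding comm_subbase_def using assms
    by (intro CollectI exI[of _ "swap r s"] exI[of _ "swap u v"]) simp
  finally show ?thesis
    unfolding zariski_topology'_def by (intro topology_generated_by_Basis) blast
qed

lemma zariski'_nbhd_infinite:
  assumes "infinite X" "x0 \<in> H" "p \<in> X"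
  shows "\<exists>V. openin (zariski_topology' G) V \<and> x0 \<in> V \<and> V \<subseteq> {x \<in> H. x p = x0 p}"
proof -
  define q where "q = x0 p"
  have q: "q \<in> X" using assms by (simp add: q_def)
  have "infinite (X - {p})" using assms by simp
  then obtain W where W: "W \<subseteq> X - {p}" "finite W" "card W = 3"
    by (meson infinite_arbitrarily_large)
  have "infinite (X - insert q (x0 ` W))" using assms W by simp
  then obtain S where S: "S \<subseteq> X - insert q (x0 ` W)" "finite S" "card S = 2"
    by (meson infinite_arbitrarily_large)
  \<comment> \<open>If \<open>x \<in> ?V\<close> but \<open>x p \<notin> {q, s}\<close>, then \<open>x\<close> sends the three points of \<open>W\<close> into \<open>{q, s}\<close>.
    So \<open>x p\<close> lies in \<open>{q, s}\<close> for both \<open>s \<in> S\<close>.\<close>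
  let ?V = "\<Inter>v\<in>W. \<Inter>s\<in>S. {x \<in> H. (x p \<in> {q, s}) \<noteq> (x v \<in> {q, s})}"
  have ne: "W \<noteq> {}" "S \<noteq> {}" using W S by auto
  show ?thesis
  proof (intro exI[of _ ?V] conjI)
    show "openin (zariski_topology' G) ?V"
      using W S ne q assms(3)
      by (intro openin_INT2 openin_zariski'_swap) auto
    have "x0 v \<noteq> q" if "v \<in> W" for v
      using W that assms by (auto simp: q_def H_apply_eq_iff)
    then show "x0 \<in> ?V" using S assms(2) by (auto simp: q_def)
    show "?V \<subseteq> {x \<in> H. x p = x0 p}"
    proof
      fix x assume x: "x \<in> ?V"
      with ne have xH: "x \<in> H" by blast
      have mem: "x p \<in> {q, s}" if "s \<in> S" for s
      proof (rule ccontr)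
        assume "x p \<notin> {q, s}"
        with x that have "x ` W \<subseteq> {q, s}" by blast
        then have "card (x ` W) \<le> card {q, s}" by (intro card_mono) auto
        moreover have "card (x ` W) = card W"
          using W(1) xH by (intro card_image inj_onI) (meson H_apply_eq_iff DiffE subsetD)
        moreover have "card {q, s} \<le> 2" by (simp add: card_insert_if)
        ultimately show False using W by simp
      qed
      from S obtain s1 s2 where "S = {s1, s2}" "s1 \<noteq> s2" by (auto simp: card_2_iff)
      with mem[of s1] mem[of s2] have "x p = q" by auto
      then show "x \<in> {x \<in> H. x p = x0 p}" using xH by (simp add: q_def)
    qed
  qed
qed

text \<open>A transposition \<open>swap p t\<close> has different conjugates under \<open>g\<close>
  and \<open>h\<close> as soon as \<open>t\<close> avoids \<open>p\<close> and one further point, so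
  three points suffice.\<close>

lemma conj_subbase_separates:
  assumes "card X \<ge> 3" "g \<in> H" "h \<in> H" "g \<noteq> h"
  shows "\<exists>S \<in> conj_subbase G. g \<in> S \<and> h \<notin> S"
proof -
  from assms obtain p where p: "p \<in> X" "g p \<noteq> h p" using H_ext by blast
  \<comment> \<open>As \<open>g p \<noteq> h p\<close>, the pairs \<open>{g p, g t}\<close> and
    \<open>{h p, h t}\<close> could agree only crosswise, with \<open>g t = h p\<close>, that is
    \<open>t = u\<close>.\<close>
  define u where "u = (inv g) (h p)"
  have u: "u \<in> X" "g u = h p" using p assms by (auto simp: u_def)
  then have "u \<noteq> p" using p by auto
  have "\<not> X \<subseteq> {p, u}"
  proof
    assume "X \<subseteq> {p, u}"
    then have "card X \<le> card {p, u}" by (intro card_mono) auto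
    also have "\<dots> \<le> 2" by (simp add: card_insert_if)
    finally show False using assms(1) by simp
  qed
  then obtain t where t: "t \<in> X" "t \<noteq> p" "t \<noteq> u" by blast
  have "{g p, g t} \<noteq> {h p, h t}"
    using u t p assms by (metis H_apply_eq_iff doubleton_eq_iff)
  then have "g \<otimes> swap p t \<otimes> inv g \<noteq> h \<otimes> swap p t \<otimes> inv h"
    using p t assms by (simp add: conj_swap swap_eq_iff H_apply_eq_iff)
  moreover have "{x \<in> carrier G. x \<otimes> swap p t \<otimes> inv x \<noteq> h \<otimes> swap p t \<otimes> inv h} \<in> conj_subbase G"
    unfolding conj_subbase_def using p t assms
    by (intro CollectI exI[of _ h] exI[of _ "swap p t"]) simp
  ultimately show ?thesis using assms by (intro bexI) auto
qed

lemma zariski''_discrete_finite: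
  assumes "finite X" "card X \<ge> 3" "g \<in> H"
  shows "openin (zariski_topology'' G) {g}"
proof -
  from conj_subbase_separates[OF assms(2,3)]
  obtain S where S: "\<And>h. h \<in> H \<Longrightarrow> g \<noteq> h \<Longrightarrow> S h \<in> conj_subbase G \<and> g \<in> S h \<and> h \<notin> S h"
    by metis
  have "finite H"
    by (rule finite_subset[OF H_subset_PiE]) (simp add: finite_PiE assms(1))
  \<comment> \<open>Inserting \<open>H\<close> confines the intersection to \<open>H\<close> and
    keeps the family nonempty.\<close>
  have "{g} = \<Inter> (insert H (S ` (H - {g})))"
    using S assms(3) by blast
  also have "openin (zariski_topology'' G) \<dots>"
    unfolding zariski_topology''_def using \<open>finite H\<close> S
    by (intro openin_Inter) (auto intro!: topology_generated_by_Basis)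
  finally show ?thesis .
qed

text \<open>A finite \<open>X\<close> may be too small for the auxiliary points of
  \<open>zariski'_nbhd_infinite\<close>, but then singletons are open. For infinite
  \<open>X\<close>, finitely many one-point conditions are intersected.\<close>

lemma pointwise_le_zariski':
  assumes "infinite X \<or> card X \<ge> 3" "openin (pointwise_topology X H) U"
  shows "openin (zariski_topology' G) U"
proof -
  have U: "U \<subseteq> H" "\<And>x. x \<in> U \<Longrightarrow> \<exists>F. finite F \<and> F \<subseteq> X \<and> {y \<in> H. \<forall>p\<in>F. y p = x p} \<subseteq> U"
    using assms(2) by (auto simp: openin_pointwise_topology_iff[OF H_subset_PiE])
  have "\<exists>V. openin (zariski_topology' G) V \<and> x \<in> V \<and> V \<subseteq> U" if x: "x \<in> U" for x
  proof (cases "finite X")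
    case True
    then show ?thesis
      using zariski''_discrete_finite[of x] assms(1) x U(1)
      by (intro exI[of _ "{x}"]) (auto intro: zariski_topology''_le_zariski_topology')
  next
    case False
    from U(2)[OF x] obtain F
      where F: "finite F" "F \<subseteq> X" "{y \<in> H. \<forall>p\<in>F. y p = x p} \<subseteq> U"
      by (elim exE conjE)
    have xH: "x \<in> H" using U x by blast
    have "\<forall>p\<in>F. \<exists>V. openin (zariski_topology' G) V \<and> x \<in> V \<and> V \<subseteq> {y \<in> H. y p = x p}"
      using F(2) by (intro ballI zariski'_nbhd_infinite[OF False xH]) (rule subsetD)
    from bchoice[OF this] obtain V where V: "\<forall>p\<in>F.
        openin (zariski_topology' G) (V p) \<and> x \<in> V p \<and> V p \<subseteq> {y \<in> H. y p = x p}"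
      by (elim exE)
    have "openin (zariski_topology' G) H"
      unfolding zariski_topology'_def by (intro topology_generated_by_Basis) simp
    then have "openin (zariski_topology' G) (\<Inter> (insert H (V ` F)))"
      using F(1) V by (intro openin_Inter) auto
    moreover have "x \<in> \<Inter> (insert H (V ` F))" using V xH by blast
    moreover have "\<Inter> (insert H (V ` F)) \<subseteq> {y \<in> H. \<forall>p\<in>F. y p = x p}"
      using V by fastforce
    then have "\<Inter> (insert H (V ` F)) \<subseteq> U" using F(3) by (rule subset_trans)
    ultimately show ?thesis by (intro exI conjI)
  qed
  then show ?thesis by (subst openin_subopen) blast
qed

section \<open>Zariski open sets are pointwise open\<close>

lemma word_value_in_H:
  assumes "x \<in> H" "set ws \<subseteq> {-1, 1} \<times> H"
  shows "word_value G ws x \<in> H"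
  using assms(2) by (induction ws) (use assms(1) in \<open>auto simp: word_value_def int_pow_neg\<close>)

text \<open>Reading the word from the right, \<open>p\<close> follows a finite trajectory.
  \<open>F\<close> collects, for each letter, a point where the value of \<open>x\<close> determines
  the step.\<close>

lemma word_value_locally_determined:
  assumes "x \<in> H" "set ws \<subseteq> {-1, 1} \<times> H" "p \<in> X"
  shows "\<exists>F. finite F \<and> F \<subseteq> X \<and>
    (\<forall>y\<in>H. (\<forall>f\<in>F. y f = x f) \<longrightarrow> word_value G ws y p = word_value G ws x p)"
  using assms(2)
proof (induction ws)
  case Nil
  then show ?case by (intro exI[of _ "{}"]) (simp add: word_value_def)
next
  case (Cons eg ws)
  obtain e g where eg: "eg = (e, g)" by force
  with Cons.prems have e: "e = 1 \<or> e = -1" and g: "g \<in> H" and ws: "set ws \<subseteq> {-1, 1} \<times> H"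
    by auto
  from Cons.IH[OF ws] obtain F where F: "finite F" "F \<subseteq> X"
    and eq: "\<And>y. y \<in> H \<Longrightarrow> \<forall>f\<in>F. y f = x f \<Longrightarrow> word_value G ws y p = word_value G ws x p"
    by blast
  define q where "q = g (word_value G ws x p)"
  have q: "q \<in> X"
    using assms(1,3) g ws by (simp add: q_def word_value_in_H)
  \<comment> \<open>For an inverse letter the point recorded is the preimage of \<open>q\<close>: if
    \<open>y\<close> agrees with \<open>x\<close> there, then \<open>y\<close> sends it to
    \<open>q\<close> as well, so \<open>inv y\<close> and \<open>inv x\<close> agree at
    \<open>q\<close>.\<close>
  define f0 where "f0 = (if e = 1 then q else (inv x) q)"
  have f0: "f0 \<in> X" using q assms(1) by (simp add: f0_def)
  have step: "word_value G (eg # ws) y p = (y [^] e) (g (word_value G ws y p))" if "y \<in> H" for y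
  proof -
    have "word_value G (eg # ws) y = y [^] e \<otimes> g \<otimes> word_value G ws y"
      by (simp add: eg word_value_def)
    moreover have "y [^] e \<in> H" using that int_pow_closed[of y e] by simp
    ultimately show ?thesis using that g ws assms(3) by (simp add: word_value_in_H)
  qed
  have "word_value G (eg # ws) y p = word_value G (eg # ws) x p"
    if y: "y \<in> H" and agree: "\<forall>f\<in>insert f0 F. y f = x f" for y
  proof -
    have "(y [^] e) q = (x [^] e) q"
    proof (cases "e = 1")
      case True
      with agree y assms(1) show ?thesis by (simp add: f0_def)
    next
      case False
      with e have e': "e = -1" by simp
      have "y ((inv x) q) = q" using agree False q assms(1) by (simp add: f0_def)
      then have "(inv y) q = (inv x) q"
        using y q assms(1) by (metis H_apply_closed inv_apply_left inv_in_H)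
      then show ?thesis using y assms(1) by (simp add: e' int_pow_neg)
    qed
    moreover have "word_value G ws y p = word_value G ws x p" using eq y agree by blast
    ultimately show ?thesis using y assms(1) by (simp add: step q_def)
  qed
  with F f0 show ?case by (intro exI[of _ "insert f0 F"]) simp
qed

text \<open>A word value other than \<open>\<one>\<close> moves some \<open>p\<close>, and every
  \<open>y\<close> that agrees with \<open>x\<close> on the finite set determined by
  \<open>p\<close> moves \<open>p\<close> to the same place.\<close>

lemma zariski_le_pointwise:
  assumes "openin (zariski_topology G) U"
  shows "openin (pointwise_topology X H) U"
proof (rule openin_topology_generated_by_le[OF _ assms[unfolded zariski_topology_def]])
  fix S assume S: "S \<in> insert (carrier G) {{x \<in> carrier G. word_value G ws x \<noteq> \<one>} | ws.
        ws \<noteq> [] \<and> set ws \<subseteq> {-1, 1} \<times> carrier G}"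
  show "openin (pointwise_topology X H) S"
  proof (cases "S = H")
    case True
    then show ?thesis
      by (auto simp: openin_pointwise_topology_iff[OF H_subset_PiE] intro: exI[of _ "{}"])
  next
    case False
    with S obtain ws where ws: "set ws \<subseteq> {-1, 1} \<times> H"
      and S: "S = {x \<in> H. word_value G ws x \<noteq> \<one>}"
      by auto
    have "\<exists>F. finite F \<and> F \<subseteq> X \<and> {y \<in> H. \<forall>p\<in>F. y p = x p} \<subseteq> S" if x: "x \<in> S" for x
    proof -
      from x S obtain p where p: "p \<in> X" "word_value G ws x p \<noteq> p"
        using H_ext[of "word_value G ws x" \<one>] word_value_in_H[OF _ ws, of x] by auto
      from x S have "x \<in> H" by simp
      from word_value_locally_determined[OF this ws p(1)] obtain F where F: "finite F" "F \<subseteq> X"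
        "\<And>y. y \<in> H \<Longrightarrow> \<forall>f\<in>F. y f = x f \<Longrightarrow> word_value G ws y p = word_value G ws x p"
        by blast
      have "word_value G ws y \<noteq> \<one>" if "y \<in> H" "\<forall>f\<in>F. y f = x f" for y
        using F(3)[OF that] p by (metis one_apply)
      with F(1,2) show ?thesis unfolding S by blast
    qed
    then show ?thesis
      unfolding openin_pointwise_topology_iff[OF H_subset_PiE] using S by blast
  qed
qed

section \<open>Strictness of the inclusion for infinite \<open>X\<close>\<close>

text \<open>Values are chosen greedily: each new one only has to avoid a finite subset of the
  infinite set \<open>X\<close>.\<close>

lemma generic_injection:
  assumes "infinite X" "finite A" "finite D" "\<And>d. d \<in> D \<Longrightarrow> inj_on d X" "finite F"
  shows "\<exists>\<phi>. inj_on \<phi> F \<and> \<phi> ` F \<subseteq> X - A \<and>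
    (\<forall>f\<in>F. \<forall>f'\<in>F. f \<noteq> f' \<longrightarrow> (\<forall>d\<in>D. d (\<phi> f') \<noteq> \<phi> f))"
  using assms(5)
proof (induction F)
  case (insert a F)
  from insert.IH obtain \<phi> where \<phi>: "inj_on \<phi> F" "\<phi> ` F \<subseteq> X - A"
    and generic: "\<forall>f\<in>F. \<forall>f'\<in>F. f \<noteq> f' \<longrightarrow> (\<forall>d\<in>D. d (\<phi> f') \<noteq> \<phi> f)"
    by (elim exE conjE)
  \<comment> \<open>The last two pieces exclude \<open>d (\<phi> f) = z\<close> and
    \<open>d z = \<phi> f\<close>; the preimages are finite because each \<open>d\<close> is
    injective on \<open>X\<close>.\<close>
  let ?B = "A \<union> \<phi> ` F \<union> (\<Union>d\<in>D. d ` \<phi> ` F) \<union> (\<Union>d\<in>D. d -` (\<phi> ` F) \<inter> X)"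
  have "finite (d -` (\<phi> ` F) \<inter> X)" if "d \<in> D" for d
    using assms(4)[OF that] insert.hyps(1) by (intro finite_vimage_IntI) auto
  with assms(2,3) insert.hyps(1) have "finite ?B"
    by (intro finite_UnI finite_UN_I finite_imageI)
  with assms(1) have "infinite (X - ?B)" by simp
  then obtain z where "z \<in> X - ?B" by (metis ex_in_conv finite.emptyI)
  then have z: "z \<in> X" "z \<notin> A" "\<And>f. f \<in> F \<Longrightarrow> z \<noteq> \<phi> f"
    "\<And>d f. d \<in> D \<Longrightarrow> f \<in> F \<Longrightarrow> d (\<phi> f) \<noteq> z" "\<And>d f. d \<in> D \<Longrightarrow> f \<in> F \<Longrightarrow> d z \<noteq> \<phi> f"
    by blast+
  let ?\<psi> = "\<phi>(a := z)"
  have \<psi>: "?\<psi> a = z" "\<And>f. f \<in> F \<Longrightarrow> ?\<psi> f = \<phi> f" using insert.hyps(2) by auto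
  have "inj_on ?\<psi> (insert a F)"
    using \<phi>(1) z(3) insert.hyps(2) by (auto simp: inj_on_def)
  moreover have "?\<psi> ` insert a F \<subseteq> X - A"
    using \<phi>(2) z(1,2) by auto
  moreover have "d (?\<psi> f') \<noteq> ?\<psi> f"
    if "f \<in> insert a F" "f' \<in> insert a F" "f \<noteq> f'" "d \<in> D" for f f' d
    using that z(4,5) generic \<psi> by (metis insertE)
  ultimately show ?case by blast
qed simp

lemma generic_element:
  assumes "infinite X" "finite D" "D \<subseteq> H" "finite F" "F \<subseteq> X"
  shows "\<exists>x\<in>H. (\<forall>f\<in>F. x f \<notin> F) \<and> (\<forall>f\<in>F. \<forall>f'\<in>F. f \<noteq> f' \<longrightarrow> (\<forall>d\<in>D. d (x f') \<noteq> x f))"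
proof -
  have "\<exists>\<phi>. inj_on \<phi> F \<and> \<phi> ` F \<subseteq> X - F \<and>
    (\<forall>f\<in>F. \<forall>f'\<in>F. f \<noteq> f' \<longrightarrow> (\<forall>d\<in>D. d (\<phi> f') \<noteq> \<phi> f))"
    using assms(3) by (intro generic_injection[OF assms(1,4,2) _ assms(4)])
      (meson H_bij_betw bij_betw_imp_inj_on subsetD)
  then obtain \<phi> where
    \<phi>: "inj_on \<phi> F" "\<phi> ` F \<subseteq> X - F"
    and generic: "\<forall>f\<in>F. \<forall>f'\<in>F. f \<noteq> f' \<longrightarrow> (\<forall>d\<in>D. d (\<phi> f') \<noteq> \<phi> f)"
    by (elim exE conjE)
  define x where "x p = (if p \<in> F then \<phi> p else if p \<in> \<phi> ` F then inv_into F \<phi> p else p)" for p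
  have "restrict x X \<in> H"
  proof (rule involution_in_H)
    show "x p \<in> X" if "p \<in> X" for p
      using that \<phi>(2) assms(5) by (auto simp: x_def \<phi>(1))
    show "x (x p) = p" if "p \<in> X" for p
      using \<phi>(2) by (auto simp: x_def \<phi>(1))
    show "finite {p \<in> X. x p \<noteq> p}"
      by (rule finite_subset[of _ "F \<union> \<phi> ` F"]) (auto simp: x_def assms(4))
  qed
  moreover have "restrict x X f = \<phi> f" if "f \<in> F" for f
    using that assms(5) by (auto simp: x_def)
  ultimately show ?thesis
    using \<phi>(2) generic by (intro bexI[of _ "restrict x X"]) auto
qed

lemma zariski''_neq_zariski':
  assumes "infinite X"
  shows "zariski_topology'' G \<noteq> zariski_topology' G"
proof
  assume eq: "zariski_topology'' G = zariski_topology' G"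
  from assms obtain p where p: "p \<in> X" by (metis ex_in_conv finite.emptyI)
  from zariski'_nbhd_infinite[OF assms one_in_H p] obtain V where
    V: "openin (zariski_topology'' G) V" "\<one> \<in> V" "V \<subseteq> {x \<in> H. x p = \<one> p}"
    unfolding eq by (elim exE conjE)
  obtain \<F> where \<F>: "finite \<F>" "\<F> \<subseteq> insert (carrier G) (conj_subbase G)"
    "\<F> \<noteq> {}" "\<one> \<in> \<Inter>\<F>" "\<Inter>\<F> \<subseteq> V"
    by (rule openin_topology_generated_by_finite_Inter[OF V(1)[unfolded zariski_topology''_def] V(2)])
  \<comment> \<open>Each condition is weakened to a test at one point: with
    \<open>d = a b (inv a)\<close> and \<open>v = b u\<close>, the conjugate of \<open>b\<close> by
    \<open>x\<close> sends \<open>x u\<close> to \<open>x v\<close>, so it differs from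
    \<open>d\<close> if \<open>d\<close> does not.\<close>
  have "\<exists>u v d. u \<in> X \<and> v \<in> X \<and> u \<noteq> v \<and> d \<in> H \<and> (\<forall>x\<in>H. d (x u) \<noteq> x v \<longrightarrow> x \<in> S)"
    if S: "S \<in> \<F> - {H}" for S
  proof -
    from S \<F>(2) have "S \<in> conj_subbase G" by auto
    then obtain a b where ab: "a \<in> H" "b \<in> H"
      and S_eq: "S = {x \<in> H. x \<otimes> b \<otimes> inv x \<noteq> a \<otimes> b \<otimes> inv a}"
      unfolding conj_subbase_def carrier_eq by blast
    let ?d = "a \<otimes> b \<otimes> inv a"
    have "\<one> \<in> S" using \<F>(4) S by blast
    \<comment> \<open>For \<open>b = \<one>\<close> both conjugates are trivial and \<open>S\<close>
      would be empty.\<close>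
    then have "b \<noteq> \<one>" using ab by (auto simp: S_eq)
    then obtain u where u: "u \<in> X" "b u \<noteq> u" using ab H_ext[of b \<one>] by auto
    have "x \<in> S" if x: "x \<in> H" "?d (x u) \<noteq> x (b u)" for x
    proof -
      have "(x \<otimes> b \<otimes> inv x) (x u) = x (b u)" using x ab u by simp
      with x show ?thesis unfolding S_eq by auto
    qed
    with u ab show ?thesis
      by (intro exI[of _ u] exI[of _ "b u"] exI[of _ ?d]) auto
  qed
  then have "\<forall>S\<in>\<F> - {H}. \<exists>u v d. u \<in> X \<and> v \<in> X \<and> u \<noteq> v \<and> d \<in> H \<and>
      (\<forall>x\<in>H. d (x u) \<noteq> x v \<longrightarrow> x \<in> S)"
    by (rule ballI)
  then obtain u v d where uvd: "\<forall>S\<in>\<F> - {H}. u S \<in> X \<and> v S \<in> X \<and> u S \<noteq> v S \<and> d S \<in> H \<and>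
      (\<forall>x\<in>H. d S (x (u S)) \<noteq> x (v S) \<longrightarrow> x \<in> S)"
    unfolding bchoice_iff by (elim exE)
  \<comment> \<open>Including \<open>p\<close> ensures that a generic \<open>x\<close>, which maps
    \<open>?F\<close> off itself, moves \<open>p\<close>.\<close>
  let ?F = "insert p (u ` (\<F> - {H}) \<union> v ` (\<F> - {H}))"
  have "\<exists>x\<in>H. (\<forall>f\<in>?F. x f \<notin> ?F) \<and>
      (\<forall>f\<in>?F. \<forall>f'\<in>?F. f \<noteq> f' \<longrightarrow> (\<forall>d\<in>d ` (\<F> - {H}). d (x f') \<noteq> x f))"
    using \<F>(1) uvd p by (intro generic_element[OF assms]) auto
  then obtain x where x: "x \<in> H" "\<forall>f\<in>?F. x f \<notin> ?F"
    "\<forall>f\<in>?F. \<forall>f'\<in>?F. f \<noteq> f' \<longrightarrow> (\<forall>d\<in>d ` (\<F> - {H}). d (x f') \<noteq> x f)"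
    by (elim bexE conjE)
  have "x \<in> S" if "S \<in> \<F>" for S
  proof (cases "S = H")
    case False
    with that have S: "S \<in> \<F> - {H}" by blast
    from bspec[OF uvd S] have uv: "u S \<noteq> v S" "d S (x (u S)) \<noteq> x (v S) \<longrightarrow> x \<in> S"
      using x(1) by auto
    have "v S \<in> ?F" "u S \<in> ?F" "d S \<in> d ` (\<F> - {H})" using S by auto
    with x(3) uv(1) have "d S (x (u S)) \<noteq> x (v S)" by metis
    with uv(2) show ?thesis by blast
  qed (use x in simp)
  then have "x \<in> \<Inter>\<F>" by (rule InterI)
  with \<F>(5) have "x \<in> V" by (rule subsetD)
  with V(3) have "x \<in> {x \<in> H. x p = \<one> p}" by (rule subsetD)
  with p have "x p = p" by simp
  moreover have "x p \<notin> ?F" by (rule bspec[OF x(2)]) simp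
  ultimately show False by simp
qed

end

theorem theorem2p1:
  fixes X :: "'a set" and H :: "('a \<Rightarrow> 'a) set" and G :: "('a \<Rightarrow> 'a) monoid"
  assumes "infinite X \<or> card X \<ge> 3"
    and "subgroup H (BijGroup X)"
    and "finitary_perms X \<subseteq> H"
  defines "G \<equiv> (BijGroup X)\<lparr>carrier := H\<rparr>"
  shows "{U. openin (zariski_topology'' G) U} \<subseteq> {U. openin (zariski_topology' G) U}
    \<and> zariski_topology' G = zariski_topology G
    \<and> zariski_topology G = pointwise_topology X H
    \<and> (infinite X \<longrightarrow> zariski_topology'' G \<noteq> zariski_topology' G)"
proof -
  interpret finitary_perm_group X H G
    by (rule finitary_perm_group.intro) (use assms(2,3) in \<open>simp_all add: G_def\<close>)
  \<comment> \<open>Three inclusions form a cycle through these topologies, so all three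
    coincide.\<close>
  have "zariski_topology' G = zariski_topology G" "zariski_topology G = pointwise_topology X H"
    unfolding topology_eq
    using zariski_topology'_le_zariski_topology zariski_le_pointwise pointwise_le_zariski'[OF assms(1)]
    by blast+
  then show ?thesis
    using zariski_topology''_le_zariski_topology' zariski''_neq_zariski' by blast
qed

end
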